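(* Let $U\subset\mathbb R^3$ be an open set (coordinates $(x,y,p)$, $p=y'$) such that for each $(x,y)$ the set $\{p:(x,y,p)\in U\}$ is an interval (possibly empty), let $W\subset\mathbb R^2$ be the projection of $U$ to the $(x,y)$-plane, and let $f:U\to\mathbb R$ be real analytic. Put $\mathfrak D=\partial_x+p\,\partial_y+f\,\partial_p$ and, for $(x,y,p)\in U$, $u_1\in\mathbb R\setminus\{0\}$, $u_3\in\mathbb R$, $$K=f_y+\tfrac29f_p^2-\tfrac13\mathfrak D(f_p),\qquad I_1=-\tfrac13f_{py}-\tfrac1{18}f_pf_{pp}+\tfrac16\mathfrak D(f_{pp}),\qquad I_2=-\frac1{6u_1^5}f_{pppp},$$ $$I_3=\frac1{u_1^2}\Big(\tfrac16f_{ppy}-\tfrac16\mathfrak D(f_{ppp})-\tfrac19f_pf_{ppp}+\tfrac1{18}f_{pp}^2\Big)+2\frac{u_3}{u_1}\Big(-\tfrac1{18}f_pf_{pp}+\tfrac16\mathfrak D(f_{pp})-\tfrac13f_{py}\Big).$$ Then the invariants $K,I_1,I_2,I_3$ all vanish identically if and only if both of the following hold: (1) $f_{pppp}=0$, i.e. $f(x,y,p)=A(x,y)p^3+3B(x,y)p^2+3C(x,y)p+D(x,y)$ on $U$ for real analytic functions $A,B,C,D$ on $W$; (2) the coefficients satisfy on $W$ $$D_y-C_x=2(BD-C^2),\qquad C_y-B_x=AD-BC,\qquad B_y-A_x=2(AC-B^2).$$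
   Context: Subscripts denote partial derivatives; $p$ is the jet coordinate standing for $y'$. $K$ is a relative invariant of the equation $y''=f(x,y,y')$ under area-preserving point transformations, and $I_1,I_2,I_3$ are the nonconstant structure functions of the invariant coframe on a $5$-dimensional bundle over $U$ with fibre coordinates $(u_1,u_3)$ in the branch $K\equiv0$; the explicit formulas in the claim are all that is needed. *)

theory Defs
  imports "HOL-Analysis.Analysis"
begin

text \<open>
  Real analyticity in several variables: near each point of the set the function is the sum of a
  power series in the coordinates. The multi-indices \<open>\<alpha>\<close> are the functions from \<open>Basis\<close> to the
  naturals, and \<open>has_sum\<close> is unconditional (hence absolute) convergence. As for \<open>analytic_on\<close>, the
  expansion is required on a full neighbourhood of each point; this is used for open sets only.
\<close>

definition real_analytic_on :: "('a::euclidean_space \<Rightarrow> real) \<Rightarrow> 'a set \<Rightarrow> bool"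
    (infix "real'_analytic'_on" 50) where
  "f real_analytic_on S \<longleftrightarrow>
     (\<forall>a\<in>S. \<exists>r>0. \<exists>c :: ('a \<Rightarrow> nat) \<Rightarrow> real. \<forall>z\<in>ball a r.
        ((\<lambda>\<alpha>. c \<alpha> * (\<Prod>b\<in>Basis. ((z - a) \<bullet> b) ^ \<alpha> b)) has_sum f z) (Basis \<rightarrow>\<^sub>E UNIV))"

text \<open>
  A point of the jet space is a triple \<open>(x, y, p)\<close>. Functions on \<open>U\<close> are represented by total
  functions; for open \<open>U\<close> the partial derivatives at points of \<open>U\<close> depend on the values on \<open>U\<close> only.
\<close>

type_synonym jet = "real \<times> real \<times> real"

definition dx :: "(jet \<Rightarrow> real) \<Rightarrow> jet \<Rightarrow> real" where
  "dx g = (\<lambda>(x, y, p). deriv (\<lambda>t. g (t, y, p)) x)"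

definition dy :: "(jet \<Rightarrow> real) \<Rightarrow> jet \<Rightarrow> real" where
  "dy g = (\<lambda>(x, y, p). deriv (\<lambda>t. g (x, t, p)) y)"

definition dp :: "(jet \<Rightarrow> real) \<Rightarrow> jet \<Rightarrow> real" where
  "dp g = (\<lambda>(x, y, p). deriv (\<lambda>t. g (x, y, t)) p)"

definition plane_dx :: "(real \<times> real \<Rightarrow> real) \<Rightarrow> real \<times> real \<Rightarrow> real" where
  "plane_dx g = (\<lambda>(x, y). deriv (\<lambda>t. g (t, y)) x)"

definition plane_dy :: "(real \<times> real \<Rightarrow> real) \<Rightarrow> real \<times> real \<Rightarrow> real" where
  "plane_dy g = (\<lambda>(x, y). deriv (\<lambda>t. g (x, t)) y)"

definition total_deriv :: "(jet \<Rightarrow> real) \<Rightarrow> (jet \<Rightarrow> real) \<Rightarrow> jet \<Rightarrow> real" where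
  "total_deriv f g = (\<lambda>(x, y, p). dx g (x, y, p) + p * dy g (x, y, p) + f (x, y, p) * dp g (x, y, p))"

text \<open>Subscripts are read from left to right: \<open>f\<^sub>p\<^sub>y\<close> is \<open>dy (dp f)\<close>.\<close>

definition inv_K :: "(jet \<Rightarrow> real) \<Rightarrow> jet \<Rightarrow> real" where
  "inv_K f z = dy f z + 2/9 * (dp f z)^2 - 1/3 * total_deriv f (dp f) z"

definition inv_I1 :: "(jet \<Rightarrow> real) \<Rightarrow> jet \<Rightarrow> real" where
  "inv_I1 f z = - 1/3 * dy (dp f) z - 1/18 * dp f z * dp (dp f) z
     + 1/6 * total_deriv f (dp (dp f)) z"

definition inv_I2 :: "(jet \<Rightarrow> real) \<Rightarrow> jet \<Rightarrow> real \<Rightarrow> real" where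
  "inv_I2 f z u1 = - (1 / (6 * u1^5)) * dp (dp (dp (dp f))) z"

definition inv_I3 :: "(jet \<Rightarrow> real) \<Rightarrow> jet \<Rightarrow> real \<Rightarrow> real \<Rightarrow> real" where
  "inv_I3 f z u1 u3 =
     1 / u1^2 * (1/6 * dy (dp (dp f)) z - 1/6 * total_deriv f (dp (dp (dp f))) z
       - 1/9 * dp f z * dp (dp (dp f)) z + 1/18 * (dp (dp f) z)^2)
     + 2 * (u3 / u1) * (- 1/18 * dp f z * dp (dp f) z + 1/6 * total_deriv f (dp (dp f)) z
       - 1/3 * dy (dp f) z)"

definition plane_projection :: "jet set \<Rightarrow> (real \<times> real) set" where
  "plane_projection U = (\<lambda>(x, y, p). (x, y)) ` U"

definition cubic_with_coeffs ::
    "jet set \<Rightarrow> (jet \<Rightarrow> real) \<Rightarrow> (real \<times> real \<Rightarrow> real) \<Rightarrow> (real \<times> real \<Rightarrow> real) \<Rightarrow>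
     (real \<times> real \<Rightarrow> real) \<Rightarrow> (real \<times> real \<Rightarrow> real) \<Rightarrow> bool" where
  "cubic_with_coeffs U f A B C D \<longleftrightarrow>
     A real_analytic_on plane_projection U \<and> B real_analytic_on plane_projection U \<and>
     C real_analytic_on plane_projection U \<and> D real_analytic_on plane_projection U \<and>
     (\<forall>x y p. (x, y, p) \<in> U \<longrightarrow>
        f (x, y, p) = A (x, y) * p^3 + 3 * B (x, y) * p^2 + 3 * C (x, y) * p + D (x, y))"

end

theory Submission
  imports Defs
begin

text \<open>
  If \<open>f\<close> is a cubic in \<open>p\<close>, then a direct computation gives
  \<open>K = E\<^sub>3 p\<^sup>2 + 2 E\<^sub>2 p + E\<^sub>1\<close>, \<open>I\<^sub>1 = - (E\<^sub>3 p + E\<^sub>2)\<close>, \<open>I\<^sub>2 = 0\<close> and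
  \<open>I\<^sub>3 = E\<^sub>3 / u\<^sub>1\<^sup>2 + 2 (u\<^sub>3 / u\<^sub>1) I\<^sub>1\<close>, where \<open>E\<^sub>1, E\<^sub>2, E\<^sub>3\<close> are the differences of the two sides
  of the three equations for the coefficients. Since \<open>I\<^sub>2 = 0\<close> forces a vanishing fourth
  derivative and every \<open>p\<close>-slice is an open interval, \<open>f\<close> is then a cubic on each slice, and
  \<open>K = 0\<close> on a nonempty open slice kills all three \<open>E\<^sub>i\<close>. The coefficients are real analytic
  because, near a given \<open>(x, y)\<close>, they are fixed linear combinations of the functions
  \<open>f (x, y, p + i h)\<close> for \<open>i = 0, 1, 2, 3\<close>.
\<close>

section \<open>Closure properties of real analytic functions and restriction to slices\<close>

lemma real_analytic_on_subset:
  assumes "f real_analytic_on T" "S \<subseteq> T"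
  shows "f real_analytic_on S"
  using assms unfolding real_analytic_on_def by blast

text \<open>The expansion is required on a full ball around each point, whatever the set is, so
  analyticity can be checked point by point. This glues local results in
  \<open>jet_cubic_coeffs_analytic\<close>.\<close>

lemma real_analytic_on_singletons:
  "f real_analytic_on S \<longleftrightarrow> (\<forall>a\<in>S. f real_analytic_on {a})"
  unfolding real_analytic_on_def by blast

text \<open>Openness lets the ball of convergence shrink into \<open>S\<close>, where both functions
  agree; the coefficients stay the same.\<close>

lemma real_analytic_on_cong:
  assumes "f real_analytic_on S" "open S" "\<And>x. x \<in> S \<Longrightarrow> f x = g x"
  shows "g real_analytic_on S"
  unfolding real_analytic_on_def
proof
  fix a assume "a \<in> S"
  obtain r c where r: "r > 0"
    and c: "\<And>z. z \<in> ball a r \<Longrightarrow>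
      ((\<lambda>\<alpha>. c \<alpha> * (\<Prod>b\<in>Basis. ((z - a) \<bullet> b) ^ \<alpha> b)) has_sum f z) (Basis \<rightarrow>\<^sub>E UNIV)"
    using assms(1) \<open>a \<in> S\<close> unfolding real_analytic_on_def by blast
  obtain e where e: "e > 0" "ball a e \<subseteq> S"
    using assms(2) \<open>a \<in> S\<close> by (meson openE)
  show "\<exists>r>0. \<exists>c. \<forall>z\<in>ball a r.
      ((\<lambda>\<alpha>. c \<alpha> * (\<Prod>b\<in>Basis. ((z - a) \<bullet> b) ^ \<alpha> b)) has_sum g z) (Basis \<rightarrow>\<^sub>E UNIV)"
  proof (intro exI[of _ "min r e"] conjI exI[of _ c] ballI)
    fix z assume "z \<in> ball a (min r e)"
    then have "z \<in> ball a r" "f z = g z"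
      using e(2) assms(3)[of z] by auto
    then show "((\<lambda>\<alpha>. c \<alpha> * (\<Prod>b\<in>Basis. ((z - a) \<bullet> b) ^ \<alpha> b)) has_sum g z) (Basis \<rightarrow>\<^sub>E UNIV)"
      using c[of z] by simp
  qed (use r e in auto)
qed

lemma real_analytic_on_add:
  assumes "f real_analytic_on S" "g real_analytic_on S"
  shows "(\<lambda>x. f x + g x) real_analytic_on S"
  unfolding real_analytic_on_def
proof
  fix a assume "a \<in> S"
  obtain r c where r: "r > 0"
    and c: "\<And>z. z \<in> ball a r \<Longrightarrow>
      ((\<lambda>\<alpha>. c \<alpha> * (\<Prod>b\<in>Basis. ((z - a) \<bullet> b) ^ \<alpha> b)) has_sum f z) (Basis \<rightarrow>\<^sub>E UNIV)"
    using assms(1) \<open>a \<in> S\<close> unfolding real_analytic_on_def by blast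
  obtain s d where s: "s > 0"
    and d: "\<And>z. z \<in> ball a s \<Longrightarrow>
      ((\<lambda>\<alpha>. d \<alpha> * (\<Prod>b\<in>Basis. ((z - a) \<bullet> b) ^ \<alpha> b)) has_sum g z) (Basis \<rightarrow>\<^sub>E UNIV)"
    using assms(2) \<open>a \<in> S\<close> unfolding real_analytic_on_def by blast
  show "\<exists>r>0. \<exists>c. \<forall>z\<in>ball a r.
      ((\<lambda>\<alpha>. c \<alpha> * (\<Prod>b\<in>Basis. ((z - a) \<bullet> b) ^ \<alpha> b)) has_sum f z + g z) (Basis \<rightarrow>\<^sub>E UNIV)"
  proof (intro exI[of _ "min r s"] conjI exI[of _ "\<lambda>\<alpha>. c \<alpha> + d \<alpha>"] ballI)
    fix z assume "z \<in> ball a (min r s)"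
    then show "((\<lambda>\<alpha>. (c \<alpha> + d \<alpha>) * (\<Prod>b\<in>Basis. ((z - a) \<bullet> b) ^ \<alpha> b)) has_sum f z + g z)
        (Basis \<rightarrow>\<^sub>E UNIV)"
      unfolding distrib_right by (intro has_sum_add c d) auto
  qed (use r s in auto)
qed

lemma real_analytic_on_cmult:
  assumes "f real_analytic_on S"
  shows "(\<lambda>x. k * f x) real_analytic_on S"
  unfolding real_analytic_on_def
proof
  fix a assume "a \<in> S"
  obtain r c where r: "r > 0"
    and c: "\<And>z. z \<in> ball a r \<Longrightarrow>
      ((\<lambda>\<alpha>. c \<alpha> * (\<Prod>b\<in>Basis. ((z - a) \<bullet> b) ^ \<alpha> b)) has_sum f z) (Basis \<rightarrow>\<^sub>E UNIV)"
    using assms(1) \<open>a \<in> S\<close> unfolding real_analytic_on_def by blast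
  show "\<exists>r>0. \<exists>c. \<forall>z\<in>ball a r.
      ((\<lambda>\<alpha>. c \<alpha> * (\<Prod>b\<in>Basis. ((z - a) \<bullet> b) ^ \<alpha> b)) has_sum k * f z) (Basis \<rightarrow>\<^sub>E UNIV)"
  proof (intro exI[of _ r] conjI exI[of _ "\<lambda>\<alpha>. k * c \<alpha>"] ballI)
    fix z assume "z \<in> ball a r"
    then show "((\<lambda>\<alpha>. k * c \<alpha> * (\<Prod>b\<in>Basis. ((z - a) \<bullet> b) ^ \<alpha> b)) has_sum k * f z)
        (Basis \<rightarrow>\<^sub>E UNIV)"
      unfolding mult.assoc by (intro has_sum_cmult_right c)
  qed (use r in auto)
qed

lemma real_analytic_on_diff:
  assumes "f real_analytic_on S" "g real_analytic_on S"
  shows "(\<lambda>x. f x - g x) real_analytic_on S"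
  using real_analytic_on_add[OF assms(1) real_analytic_on_cmult[OF assms(2), of "-1"]] by simp

text \<open>
  All terms of the power series whose multi-index is not supported on the image of the basis
  vanish on the slice.
\<close>

lemma real_analytic_on_slice:
  fixes L :: "'a::euclidean_space \<Rightarrow> 'b::euclidean_space"
  assumes f: "f real_analytic_on S" and L: "linear L" "inj_on L Basis" "L ` Basis \<subseteq> Basis"
  shows "(\<lambda>z. f (v + L z)) real_analytic_on {z. v + L z \<in> S}"
  unfolding real_analytic_on_def
proof
  fix a assume "a \<in> {z. v + L z \<in> S}"
  then obtain r c where r: "r > 0"
    and c: "\<And>z. z \<in> ball (v + L a) r \<Longrightarrow>
      ((\<lambda>\<alpha>. c \<alpha> * (\<Prod>b\<in>Basis. ((z - (v + L a)) \<bullet> b) ^ \<alpha> b)) has_sum f z) (Basis \<rightarrow>\<^sub>E UNIV)"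
    using f unfolding real_analytic_on_def by blast
  have L_sum: "L z = (\<Sum>i\<in>Basis. (z \<bullet> i) *\<^sub>R L i)" for z
    by (subst euclidean_representation[symmetric, of z])
      (simp add: linear_sum[OF L(1)] linear_scale[OF L(1)])
  have L_Basis: "L i \<bullet> L j = (if i = j then 1 else 0)" if "i \<in> Basis" "j \<in> Basis" for i j
    using that L(2,3) by (auto simp: inner_Basis inj_on_eq_iff image_subset_iff)
  have L_inner: "L z \<bullet> L b = z \<bullet> b" if "b \<in> Basis" for z b
    by (simp add: L_sum[of z] inner_sum_left L_Basis that if_distrib cong: if_cong sum.cong)
  have L_orth: "L z \<bullet> b = 0" if "b \<in> Basis - L ` Basis" for z b
  proof -
    have "L i \<bullet> b = 0" if "i \<in> Basis" for i
      using \<open>b \<in> Basis - L ` Basis\<close> that L(3) by (subst inner_Basis) auto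
    then show ?thesis
      by (simp add: L_sum[of z] inner_sum_left)
  qed
  \<comment> \<open>Distinct basis vectors go to distinct basis vectors, so \<open>L\<close> is an
    isometric embedding and the radius \<open>r\<close> serves for the slice unchanged.\<close>
  have L_inner': "L z \<bullet> L w = z \<bullet> w" for z w
    by (simp add: L_sum[of w] inner_sum_right L_inner euclidean_inner[of z w] mult.commute)
  have L_dist: "dist (L z) (L w) = dist z w" for z w
    by (simp add: dist_norm norm_eq_sqrt_inner L_inner' linear_diff[OF L(1), symmetric])
  \<comment> \<open>\<open>e\<close> carries the exponents along \<open>L\<close> and puts exponent
    0 at every basis vector outside the image of \<open>L\<close>.\<close>
  define e :: "('a \<Rightarrow> nat) \<Rightarrow> 'b \<Rightarrow> nat" where
    "e \<alpha> = (\<lambda>b\<in>Basis. if b \<in> L ` Basis then \<alpha> (inv_into Basis L b) else 0)" for \<alpha>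
  have e_L: "e \<alpha> (L b) = \<alpha> b" if "b \<in> Basis" for \<alpha> b
    using that L(2,3) by (auto simp: e_def)
  have e_inj: "inj_on e (Basis \<rightarrow>\<^sub>E UNIV)"
  proof (rule inj_onI)
    fix \<alpha> \<beta> :: "'a \<Rightarrow> nat"
    assume "\<alpha> \<in> Basis \<rightarrow>\<^sub>E UNIV" "\<beta> \<in> Basis \<rightarrow>\<^sub>E UNIV" "e \<alpha> = e \<beta>"
    then show "\<alpha> = \<beta>"
      by (metis PiE_ext e_L)
  qed
  have e_image: "\<alpha> \<in> e ` (Basis \<rightarrow>\<^sub>E UNIV)"
    if "\<alpha> \<in> Basis \<rightarrow>\<^sub>E UNIV" "\<And>b. b \<in> Basis - L ` Basis \<Longrightarrow> \<alpha> b = 0" for \<alpha>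
  proof (rule image_eqI)
    show "\<alpha> = e (\<lambda>b\<in>Basis. \<alpha> (L b))"
      by (rule PiE_ext[OF that(1)])
        (use that(2) L(2) in \<open>auto simp: e_def inv_into_into f_inv_into_f\<close>)
  qed auto
  show "\<exists>r>0. \<exists>c. \<forall>z\<in>ball a r.
      ((\<lambda>\<alpha>. c \<alpha> * (\<Prod>b\<in>Basis. ((z - a) \<bullet> b) ^ \<alpha> b)) has_sum f (v + L z)) (Basis \<rightarrow>\<^sub>E UNIV)"
  proof (intro exI[of _ r] conjI exI[of _ "\<lambda>\<alpha>. c (e \<alpha>)"] ballI)
    fix z assume "z \<in> ball a r"
    define t where "t = (\<lambda>\<alpha>. c \<alpha> * (\<Prod>b\<in>Basis. (L (z - a) \<bullet> b) ^ \<alpha> b))"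
    have "(t has_sum f (v + L z)) (Basis \<rightarrow>\<^sub>E UNIV)"
      using c[of "v + L z"] \<open>z \<in> ball a r\<close>
      by (simp add: t_def L_dist linear_diff[OF L(1)])
    moreover have "t \<alpha> = 0" if \<alpha>: "\<alpha> \<in> (Basis \<rightarrow>\<^sub>E UNIV) - e ` (Basis \<rightarrow>\<^sub>E UNIV)" for \<alpha>
    proof -
      obtain b where b: "b \<in> Basis - L ` Basis" "\<alpha> b \<noteq> 0"
        using DiffD1[OF \<alpha>] DiffD2[OF \<alpha>] e_image[of \<alpha>] by metis
      then have "(L (z - a) \<bullet> b) ^ \<alpha> b = 0"
        by (simp add: L_orth)
      then show ?thesis
        using b by (auto simp: t_def)
    qed
    moreover have "e ` (Basis \<rightarrow>\<^sub>E UNIV) \<subseteq> Basis \<rightarrow>\<^sub>E UNIV"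
      by (auto simp: e_def)
    \<comment> \<open>Dropping the vanishing terms leaves the sum over the image of
      \<open>e\<close>, which is then reindexed along the injective \<open>e\<close>.\<close>
    ultimately have "(t has_sum f (v + L z)) (e ` (Basis \<rightarrow>\<^sub>E UNIV))"
      by (subst has_sum_cong_neutral[where T = "Basis \<rightarrow>\<^sub>E UNIV" and g = t]) (blast+)
    then have "((\<lambda>\<alpha>. t (e \<alpha>)) has_sum f (v + L z)) (Basis \<rightarrow>\<^sub>E UNIV)"
      by (simp add: has_sum_reindex[OF e_inj] o_def)
    moreover have "t (e \<alpha>) = c (e \<alpha>) * (\<Prod>b\<in>Basis. ((z - a) \<bullet> b) ^ \<alpha> b)" for \<alpha>
    proof -
      have "(\<Prod>b\<in>Basis. (L (z - a) \<bullet> b) ^ e \<alpha> b) = (\<Prod>b\<in>L ` Basis. (L (z - a) \<bullet> b) ^ e \<alpha> b)"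
        using L(3) by (intro prod.mono_neutral_right) (auto simp: e_def)
      also have "\<dots> = (\<Prod>b\<in>Basis. ((z - a) \<bullet> b) ^ \<alpha> b)"
        by (simp add: prod.reindex[OF L(2)] L_inner e_L)
      finally show ?thesis
        by (simp add: t_def)
    qed
    ultimately show "((\<lambda>\<alpha>. c (e \<alpha>) * (\<Prod>b\<in>Basis. ((z - a) \<bullet> b) ^ \<alpha> b)) has_sum f (v + L z))
        (Basis \<rightarrow>\<^sub>E UNIV)"
      by simp
  qed (use r in auto)
qed

section \<open>Real analytic functions of one variable and their derivatives\<close>

text \<open>The only basis vector of the reals is 1, so a multi-index amounts to a single natural
  number.\<close>

lemma has_sum_real_Basis_iff:
  fixes c :: "(real \<Rightarrow> nat) \<Rightarrow> real"
  shows "((\<lambda>\<alpha>. c \<alpha> * (\<Prod>b\<in>Basis. (x \<bullet> b) ^ \<alpha> b)) has_sum s) (Basis \<rightarrow>\<^sub>E UNIV) \<longleftrightarrow>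
    ((\<lambda>n. c (\<lambda>b\<in>Basis. n) * x ^ n) has_sum s) UNIV"
proof -
  have "bij_betw (\<lambda>n. \<lambda>b\<in>(Basis :: real set). n) (UNIV :: nat set) (Basis \<rightarrow>\<^sub>E UNIV)"
    by (rule bij_betwI[where g = "\<lambda>\<alpha>. \<alpha> 1"]) (auto simp: fun_eq_iff PiE_def extensional_def)
  from has_sum_reindex_bij_betw[OF this, of "\<lambda>\<alpha>. c \<alpha> * (\<Prod>b\<in>Basis. (x \<bullet> b) ^ \<alpha> b)" s]
  show ?thesis by simp
qed

text \<open>Reduces the one-variable case to ordinary power series. Conditional and unconditional
  convergence agree because a power series converges absolutely inside its interval of
  convergence.\<close>

lemma real_analytic_on_real_iff:
  fixes g :: "real \<Rightarrow> real"
  shows "g real_analytic_on S \<longleftrightarrow>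
    (\<forall>a\<in>S. \<exists>r>0. \<exists>c. \<forall>x. \<bar>x\<bar> < r \<longrightarrow> (\<lambda>n. c n * x ^ n) sums g (a + x))" (is "?L \<longleftrightarrow> ?R")
proof
  assume ?L
  show ?R
  proof
    fix a assume "a \<in> S"
    then obtain r c where r: "r > 0"
      and c: "\<And>z. z \<in> ball a r \<Longrightarrow>
        ((\<lambda>\<alpha>. c \<alpha> * (\<Prod>b\<in>Basis. ((z - a) \<bullet> b) ^ \<alpha> b)) has_sum g z) (Basis \<rightarrow>\<^sub>E UNIV)"
      using \<open>?L\<close> unfolding real_analytic_on_def by blast
    have "(\<lambda>n. c (\<lambda>b\<in>Basis. n) * x ^ n) sums g (a + x)" if "\<bar>x\<bar> < r" for x
      using c[of "a + x"] that unfolding has_sum_real_Basis_iff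
      by (intro has_sum_imp_sums) (simp add: dist_norm)
    then show "\<exists>r>0. \<exists>c. \<forall>x. \<bar>x\<bar> < r \<longrightarrow> (\<lambda>n. c n * x ^ n) sums g (a + x)"
      using r by (intro exI[of _ r] conjI exI[of _ "\<lambda>n. c (\<lambda>b\<in>Basis. n)"]) auto
  qed
next
  assume ?R
  show ?L
    unfolding real_analytic_on_def has_sum_real_Basis_iff
  proof
    fix a assume "a \<in> S"
    then obtain r c where r: "r > 0"
      and c: "\<And>x. \<bar>x\<bar> < r \<Longrightarrow> (\<lambda>n. c n * x ^ n) sums g (a + x)"
      using \<open>?R\<close> by blast
    show "\<exists>r>0. \<exists>c. \<forall>z\<in>ball a r.
      ((\<lambda>n. c (\<lambda>b\<in>(Basis :: real set). n) * (z - a) ^ n) has_sum g z) UNIV"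
    \<comment> \<open>The coefficient of a multi-index is looked up at its value on the basis vector
      1.\<close>
    proof (intro exI[of _ r] conjI exI[of _ "\<lambda>\<alpha>. c (\<alpha> 1)"] ballI)
      fix z assume "z \<in> ball a r"
      then have z: "\<bar>z - a\<bar> < r"
        by (simp add: dist_real_def abs_minus_commute)
      \<comment> \<open>A point strictly between the distance of \<open>z\<close> from
        \<open>a\<close> and \<open>r\<close>: convergence there forces absolute convergence at
        \<open>z - a\<close>.\<close>
      define y where "y = (\<bar>z - a\<bar> + r) / 2"
      have "\<bar>z - a\<bar> < \<bar>y\<bar>" "\<bar>y\<bar> < r"
        using z by (auto simp: y_def)
      then have "summable (\<lambda>n. norm (c n * (z - a) ^ n))"
        using c[of y] by (intro powser_insidea[of c y]) (auto simp: sums_iff)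
      then have "((\<lambda>n. c n * (z - a) ^ n) has_sum g z) UNIV"
        using c[OF z] by (intro norm_summable_imp_has_sum) auto
      then show "((\<lambda>n. c ((\<lambda>b\<in>(Basis :: real set). n) 1) * (z - a) ^ n) has_sum g z) UNIV"
        by simp
    qed (use r in auto)
  qed
qed

text \<open>Termwise differentiation of the series, carried over to \<open>g\<close> because both
  agree near \<open>x\<close> up to the shift by \<open>a\<close>.\<close>

lemma has_field_derivative_of_power_series:
  fixes g :: "real \<Rightarrow> real"
  assumes c: "\<And>x. \<bar>x\<bar> < r \<Longrightarrow> (\<lambda>n. c n * x ^ n) sums g (a + x)" and x: "\<bar>x\<bar> < r"
  shows "(g has_field_derivative (\<Sum>n. diffs c n * x ^ n)) (at (a + x))"
proof -
  have "((\<lambda>z. \<Sum>n. c n * z ^ n) has_field_derivative (\<Sum>n. diffs c n * x ^ n)) (at x)"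
    using c x by (intro termdiffs_strong'[where K = r]) (auto simp: sums_iff)
  moreover have "\<forall>\<^sub>F z in nhds x. (\<Sum>n. c n * z ^ n) = g (z + a)"
    using c x by (intro eventually_nhds_in_open[of "ball 0 r" x, THEN eventually_mono])
      (auto simp: sums_iff add.commute)
  ultimately have "((\<lambda>z. g (z + a)) has_field_derivative (\<Sum>n. diffs c n * x ^ n)) (at x)"
    using DERIV_cong_ev[OF refl _ refl] by metis
  then show ?thesis
    by (metis DERIV_shift add.commute)
qed

lemma real_analytic_on_imp_field_differentiable:
  fixes g :: "real \<Rightarrow> real"
  assumes "g real_analytic_on S" "a \<in> S"
  shows "g field_differentiable at a"
proof -
  obtain r c where "r > 0" "\<And>x. \<bar>x\<bar> < r \<Longrightarrow> (\<lambda>n. c n * x ^ n) sums g (a + x)"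
    using assms unfolding real_analytic_on_real_iff by blast
  then have "(g has_field_derivative (\<Sum>n. diffs c n * 0 ^ n)) (at (a + 0))"
    by (intro has_field_derivative_of_power_series[where r = r]) auto
  then show ?thesis
    by (auto simp: field_differentiable_def)
qed

lemma real_analytic_on_deriv:
  fixes g :: "real \<Rightarrow> real"
  assumes "g real_analytic_on S"
  shows "deriv g real_analytic_on S"
  unfolding real_analytic_on_real_iff
proof
  fix a assume "a \<in> S"
  then obtain r c where r: "r > 0"
    and c: "\<And>x. \<bar>x\<bar> < r \<Longrightarrow> (\<lambda>n. c n * x ^ n) sums g (a + x)"
    using assms unfolding real_analytic_on_real_iff by blast
  have "(\<lambda>n. diffs c n * x ^ n) sums deriv g (a + x)" if "\<bar>x\<bar> < r" for x
  proof -
    have "summable (\<lambda>n. diffs c n * x ^ n)"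
      using c that by (intro termdiff_converges[where K = r]) (auto simp: sums_iff)
    then show ?thesis
      using has_field_derivative_of_power_series[OF c that] by (simp add: DERIV_imp_deriv summable_sums)
  qed
  then show "\<exists>r>0. \<exists>c. \<forall>x. \<bar>x\<bar> < r \<longrightarrow> (\<lambda>n. c n * x ^ n) sums deriv g (a + x)"
    using r by blast
qed

section \<open>Slices and partial derivatives on the jet space\<close>

lemma open_jet_slices:
  assumes "open U"
  shows "open {t. (t, y, p) \<in> U}" "open {t. (x, t, p) \<in> U}" "open {t. (x, y, t) \<in> U}"
    "open {(s, t). (s, t, p) \<in> U}"
proof -
  have "open ((\<lambda>t. (t, y, p)) -` U)" "open ((\<lambda>t. (x, t, p)) -` U)" "open ((\<lambda>t. (x, y, t)) -` U)"
      "open ((\<lambda>w. (fst w, snd w, p)) -` U)"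
    by (intro open_vimage[OF assms] continuous_intros)+
  then show "open {t. (t, y, p) \<in> U}" "open {t. (x, t, p) \<in> U}" "open {t. (x, y, t) \<in> U}"
      "open {(s, t). (s, t, p) \<in> U}"
    by (simp_all add: vimage_def case_prod_unfold)
qed

text \<open>Partial derivatives are local, so an identity valid on the open set \<open>U\<close> may
  be differentiated there. This allows replacing \<open>f\<close> by an explicit cubic one
  derivative at a time.\<close>

lemma jet_partials_cong:
  assumes "open U" "z \<in> U" "\<And>w. w \<in> U \<Longrightarrow> g w = h w"
  shows "dx g z = dx h z" "dy g z = dy h z" "dp g z = dp h z"
proof -
  obtain x y p where z: "z = (x, y, p)" by (cases z)
  note slices = open_jet_slices[OF \<open>open U\<close>]
  show "dx g z = dx h z"
    using assms(2,3) unfolding z dx_def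
    by (auto intro!: deriv_cong_ev eventually_mono[OF eventually_nhds_in_open[OF slices(1)[of y p]]])
  show "dy g z = dy h z"
    using assms(2,3) unfolding z dy_def
    by (auto intro!: deriv_cong_ev eventually_mono[OF eventually_nhds_in_open[OF slices(2)[of x p]]])
  show "dp g z = dp h z"
    using assms(2,3) unfolding z dp_def
    by (auto intro!: deriv_cong_ev eventually_mono[OF eventually_nhds_in_open[OF slices(3)[of x y]]])
qed

lemma real_analytic_on_p_slice:
  fixes f :: "jet \<Rightarrow> real"
  assumes "f real_analytic_on U"
  shows "(\<lambda>p. f (x, y, p)) real_analytic_on {p. (x, y, p) \<in> U}"
proof -
  have "(\<lambda>p. f ((x, y, 0) + (0, 0, p))) real_analytic_on {p. (x, y, 0) + (0, 0, p) \<in> U}"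
    using assms
    by (rule real_analytic_on_slice) (auto intro!: linearI simp: Basis_prod_def zero_prod_def)
  then show ?thesis by simp
qed

lemma real_analytic_on_plane_slice:
  fixes f :: "jet \<Rightarrow> real"
  assumes "f real_analytic_on U"
  shows "(\<lambda>(x, y). f (x, y, p)) real_analytic_on {(x, y). (x, y, p) \<in> U}"
proof -
  have "(\<lambda>w. f ((0, 0, p) + (fst w, snd w, 0)))
      real_analytic_on {w. (0, 0, p) + (fst w, snd w, 0) \<in> U}"
    using assms
    by (rule real_analytic_on_slice) (auto intro!: linearI inj_onI simp: Basis_prod_def zero_prod_def)
  then show ?thesis by (simp add: case_prod_unfold)
qed

text \<open>Coordinate slices of an analytic function are analytic, hence differentiable, so
  \<open>deriv\<close> returns a genuine derivative here.\<close>

lemma has_field_derivative_plane: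
  fixes g :: "real \<times> real \<Rightarrow> real"
  assumes "g real_analytic_on W" "(x, y) \<in> W"
  shows "((\<lambda>t. g (t, y)) has_field_derivative plane_dx g (x, y)) (at x)"
    and "((\<lambda>t. g (x, t)) has_field_derivative plane_dy g (x, y)) (at y)"
proof -
  have "(\<lambda>t. g ((0, y) + (t, 0))) real_analytic_on {t. (0, y) + (t, 0) \<in> W}"
    using assms(1)
    by (rule real_analytic_on_slice) (auto intro!: linearI simp: Basis_prod_def)
  then have "(\<lambda>t. g (t, y)) field_differentiable at x"
    using assms(2) real_analytic_on_imp_field_differentiable by fastforce
  then show "((\<lambda>t. g (t, y)) has_field_derivative plane_dx g (x, y)) (at x)"
    by (simp add: plane_dx_def DERIV_deriv_iff_field_differentiable)
  have "(\<lambda>t. g ((x, 0) + (0, t))) real_analytic_on {t. (x, 0) + (0, t) \<in> W}"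
    using assms(1)
    by (rule real_analytic_on_slice) (auto intro!: linearI simp: Basis_prod_def)
  then have "(\<lambda>t. g (x, t)) field_differentiable at y"
    using assms(2) real_analytic_on_imp_field_differentiable by fastforce
  then show "((\<lambda>t. g (x, t)) has_field_derivative plane_dy g (x, y)) (at y)"
    by (simp add: plane_dy_def DERIV_deriv_iff_field_differentiable)
qed

section \<open>Functions of one variable with vanishing fourth derivative\<close>

lemma eq_plus_const_of_deriv:
  fixes g Q :: "real \<Rightarrow> real"
  assumes "convex S" "g real_analytic_on S"
    and "\<And>t. t \<in> S \<Longrightarrow> (Q has_field_derivative deriv g t) (at t)"
  shows "\<exists>c. \<forall>t\<in>S. g t = Q t + c"
proof -
  have "\<exists>c. \<forall>t\<in>S. g t - Q t = c"
  proof (rule has_field_derivative_zero_constant[OF \<open>convex S\<close>])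
    fix t assume "t \<in> S"
    then have "(g has_field_derivative deriv g t) (at t)"
      using real_analytic_on_imp_field_differentiable[OF assms(2)]
      by (simp add: DERIV_deriv_iff_field_differentiable)
    from DERIV_diff[OF this assms(3)[OF \<open>t \<in> S\<close>]]
    show "((\<lambda>t. g t - Q t) has_field_derivative 0) (at t within S)"
      by (simp add: has_field_derivative_at_within)
  qed
  then show ?thesis
    by (metis add.commute diff_add_cancel)
qed

text \<open>Integrate four times; convexity of \<open>S\<close> makes each integration constant
  global.\<close>

lemma cubic_of_fourth_deriv_zero:
  fixes g :: "real \<Rightarrow> real"
  assumes S: "convex S" and g: "g real_analytic_on S"
    and 0: "\<And>t. t \<in> S \<Longrightarrow> deriv (deriv (deriv (deriv g))) t = 0"
  shows "\<exists>a b c d. \<forall>t\<in>S. g t = a * t^3 + 3 * b * t^2 + 3 * c * t + d"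
proof -
  note an = real_analytic_on_deriv
  obtain a where a: "\<forall>t\<in>S. deriv (deriv (deriv g)) t = a"
    using eq_plus_const_of_deriv[OF S an[OF an[OF an[OF g]]], of "\<lambda>_. 0"] 0 by auto
  obtain b where b: "\<forall>t\<in>S. deriv (deriv g) t = a * t + b"
    using eq_plus_const_of_deriv[OF S an[OF an[OF g]], of "\<lambda>t. a * t"] a
    by (auto intro!: derivative_eq_intros)
  have "((\<lambda>t. a / 2 * t^2 + b * t) has_field_derivative deriv (deriv g) t) (at t)" if "t \<in> S" for t
    using b that by (auto intro!: derivative_eq_intros)
  from eq_plus_const_of_deriv[OF S an[OF g] this]
  obtain c where c: "\<forall>t\<in>S. deriv g t = a / 2 * t^2 + b * t + c"
    by blast
  have "((\<lambda>t. a / 6 * t^3 + b / 2 * t^2 + c * t) has_field_derivative deriv g t) (at t)"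
    if "t \<in> S" for t
    using c that by (auto intro!: derivative_eq_intros simp: field_simps)
  from eq_plus_const_of_deriv[OF S g this]
  obtain d where "\<forall>t\<in>S. g t = a / 6 * t^3 + b / 2 * t^2 + c * t + d"
    by blast
  \<comment> \<open>Rescaling the constants to the binomial normalisation with the factors
    3.\<close>
  then have "\<forall>t\<in>S. g t = (a / 6) * t^3 + 3 * (b / 6) * t^2 + 3 * (c / 3) * t + d"
    by simp
  then show ?thesis by blast
qed

section \<open>Cubics in \<open>p\<close>, their coefficients and their derivatives\<close>

text \<open>The \<open>p\<close>-derivatives of a cubic keep this shape, with zero leading
  coefficients, so one formula for the partial derivatives serves all of them.\<close>

definition jet_cubic ::
    "(real \<times> real \<Rightarrow> real) \<Rightarrow> (real \<times> real \<Rightarrow> real) \<Rightarrow> (real \<times> real \<Rightarrow> real) \<Rightarrow>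
     (real \<times> real \<Rightarrow> real) \<Rightarrow> jet \<Rightarrow> real" where
  "jet_cubic A B C D =
     (\<lambda>(x, y, p). A (x, y) * p^3 + 3 * B (x, y) * p^2 + 3 * C (x, y) * p + D (x, y))"

lemma cubic_with_coeffs_iff:
  "cubic_with_coeffs U f A B C D \<longleftrightarrow>
     A real_analytic_on plane_projection U \<and> B real_analytic_on plane_projection U \<and>
     C real_analytic_on plane_projection U \<and> D real_analytic_on plane_projection U \<and>
     (\<forall>z\<in>U. f z = jet_cubic A B C D z)"
  by (auto simp: cubic_with_coeffs_def jet_cubic_def)

lemma dp_jet_cubic:
  "dp (jet_cubic A B C D) = jet_cubic (\<lambda>_. 0) A (\<lambda>w. 2 * B w) (\<lambda>w. 3 * C w)"
proof
  fix z :: jet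
  obtain x y p where z: "z = (x, y, p)" by (cases z)
  show "dp (jet_cubic A B C D) z = jet_cubic (\<lambda>_. 0) A (\<lambda>w. 2 * B w) (\<lambda>w. 3 * C w) z"
    unfolding z dp_def jet_cubic_def prod.case
    by (rule DERIV_imp_deriv) (auto intro!: derivative_eq_intros)
qed

text \<open>No regularity of the coefficients is assumed. Finite differences in \<open>p\<close>
  recover them, in the order \<open>A\<close>, \<open>B\<close>, \<open>C\<close>, \<open>D\<close>,
  from slices of \<open>f\<close> that are analytic in \<open>(x, y)\<close>.\<close>

lemma jet_cubic_coeffs_analytic:
  fixes f :: "jet \<Rightarrow> real"
  assumes "open U" "f real_analytic_on U" "\<And>z. z \<in> U \<Longrightarrow> f z = jet_cubic A B C D z"
  shows "cubic_with_coeffs U f A B C D"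
proof -
  have "A real_analytic_on {w} \<and> B real_analytic_on {w} \<and>
      C real_analytic_on {w} \<and> D real_analytic_on {w}"
    if w: "w \<in> plane_projection U" for w
  proof -
    obtain x y p where xyp: "w = (x, y)" "(x, y, p) \<in> U"
      using w by (auto simp: plane_projection_def)
    then obtain e where e: "e > 0" "ball p e \<subseteq> {t. (x, y, t) \<in> U}"
      using open_jet_slices(3)[OF \<open>open U\<close>, of x y] by (metis mem_Collect_eq openE)
    \<comment> \<open>With this step even \<open>p + 3 * h\<close> stays inside the ball of radius
      \<open>e\<close>.\<close>
    define h where "h = e / 4"
    have h: "h > 0" using e by (simp add: h_def)
    define N where "N q = {(x, y). (x, y, q) \<in> U}" for q
    define G where "G q = (\<lambda>(x, y). f (x, y, q))" for q
    \<comment> \<open>A neighbourhood of \<open>w\<close> over which all four sample values of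
      \<open>p\<close> lie in \<open>U\<close>.\<close>
    define M where "M = N p \<inter> N (p + h) \<inter> N (p + 2 * h) \<inter> N (p + 3 * h)"
    have M_open: "open M"
      unfolding M_def N_def by (intro open_Int open_jet_slices \<open>open U\<close>)
    have "p \<in> ball p e" "p + h \<in> ball p e" "p + 2 * h \<in> ball p e" "p + 3 * h \<in> ball p e"
      using e(1) by (auto simp: h_def dist_real_def)
    then have "w \<in> M"
      using subsetD[OF e(2)] by (simp add: M_def N_def xyp(1))
    have G_N: "G q real_analytic_on N q" for q
      unfolding G_def N_def by (rule real_analytic_on_plane_slice[OF assms(2)])
    have G: "G p real_analytic_on M" "G (p + h) real_analytic_on M"
        "G (p + 2 * h) real_analytic_on M" "G (p + 3 * h) real_analytic_on M"
      by (rule real_analytic_on_subset[OF G_N], auto simp: M_def)+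
    have G_eq: "G q v = A v * q^3 + 3 * B v * q^2 + 3 * C v * q + D v" if "v \<in> N q" for q v
      using that assms(3) by (auto simp: G_def N_def jet_cubic_def)
    have vals: "G p v = A v * p^3 + 3 * B v * p^2 + 3 * C v * p + D v"
        "G (p + h) v = A v * (p + h)^3 + 3 * B v * (p + h)^2 + 3 * C v * (p + h) + D v"
        "G (p + 2 * h) v =
          A v * (p + 2 * h)^3 + 3 * B v * (p + 2 * h)^2 + 3 * C v * (p + 2 * h) + D v"
        "G (p + 3 * h) v =
          A v * (p + 3 * h)^3 + 3 * B v * (p + 3 * h)^2 + 3 * C v * (p + 3 * h) + D v"
      if "v \<in> M" for v
      by (rule G_eq, use that in \<open>simp add: M_def\<close>)+
    note intros = real_analytic_on_add real_analytic_on_diff real_analytic_on_cmult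
    \<comment> \<open>The third difference of the cubic is \<open>6 * h^3 * A\<close>.\<close>
    have "(\<lambda>v. 1 / (6 * h^3) * (G (p + 3 * h) v - 3 * G (p + 2 * h) v + 3 * G (p + h) v - G p v))
        real_analytic_on M"
      by (intro intros G)
    then have A: "A real_analytic_on M"
      by (rule real_analytic_on_cong[OF _ M_open])
        (use h in \<open>simp only: vals\<close>, simp add: field_simps power2_eq_square power3_eq_cube)
    \<comment> \<open>The second difference is \<open>6 * h^2 * ((p + h) * A + B)\<close>, and
      \<open>A\<close> is already analytic.\<close>
    have "(\<lambda>v. 1 / (6 * h^2) * (G (p + 2 * h) v - 2 * G (p + h) v + G p v) - (p + h) * A v)
        real_analytic_on M"
      by (intro intros G A)
    then have B: "B real_analytic_on M"
      by (rule real_analytic_on_cong[OF _ M_open])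
        (use h in \<open>simp only: vals\<close>, simp add: field_simps power2_eq_square power3_eq_cube)
    \<comment> \<open>The first difference divided by \<open>3 * h\<close> is \<open>C\<close> plus
      the subtracted combination of \<open>A\<close> and \<open>B\<close>.\<close>
    have "(\<lambda>v. 1 / (3 * h) * (G (p + h) v - G p v)
        - ((3 * p^2 + 3 * p * h + h^2) / 3 * A v + (2 * p + h) * B v)) real_analytic_on M"
      by (intro intros G A B)
    then have C: "C real_analytic_on M"
      by (rule real_analytic_on_cong[OF _ M_open])
        (use h in \<open>simp only: vals\<close>, simp add: field_simps power2_eq_square power3_eq_cube)
    have "(\<lambda>v. G p v - (p^3 * A v + (3 * p^2) * B v + (3 * p) * C v)) real_analytic_on M"
      by (intro intros G A B C)
    then have D: "D real_analytic_on M"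
      by (rule real_analytic_on_cong[OF _ M_open]) (simp only: vals, simp add: algebra_simps)
    show ?thesis
      using A B C D \<open>w \<in> M\<close> by (auto intro: real_analytic_on_subset[of _ M])
  qed
  then show ?thesis
    using assms(3) real_analytic_on_singletons[of _ "plane_projection U"]
    unfolding cubic_with_coeffs_iff by blast
qed

lemma cubic_with_coeffs_exists:
  fixes f :: "jet \<Rightarrow> real"
  assumes "open U" "\<And>x y. is_interval {p. (x, y, p) \<in> U}" "f real_analytic_on U"
    and "\<And>z. z \<in> U \<Longrightarrow> dp (dp (dp (dp f))) z = 0"
  shows "\<exists>A B C D. cubic_with_coeffs U f A B C D"
proof -
  \<comment> \<open>Each slice is an interval, possibly empty, so coefficients exist for every
    \<open>w\<close>; choosing them point by point gives functions, whose analyticity is supplied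
    afterwards.\<close>
  have "\<forall>w. \<exists>a b c d. \<forall>p. (fst w, snd w, p) \<in> U \<longrightarrow>
      f (fst w, snd w, p) = a * p^3 + 3 * b * p^2 + 3 * c * p + d"
  proof
    fix w :: "real \<times> real"
    obtain x y where w: "w = (x, y)" by (cases w)
    have "deriv (deriv (deriv (deriv (\<lambda>p. f (x, y, p))))) p = 0" if "(x, y, p) \<in> U" for p
      using assms(4)[OF that] by (simp add: dp_def)
    then show "\<exists>a b c d. \<forall>p. (fst w, snd w, p) \<in> U \<longrightarrow>
      f (fst w, snd w, p) = a * p^3 + 3 * b * p^2 + 3 * c * p + d"
      using cubic_of_fourth_deriv_zero[OF is_interval_convex[OF assms(2)]
          real_analytic_on_p_slice[OF assms(3)], of x y]
      by (simp add: w)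
  qed
  then obtain A B C D where ABCD: "\<And>w p. (fst w, snd w, p) \<in> U \<Longrightarrow>
      f (fst w, snd w, p) = A w * p^3 + 3 * B w * p^2 + 3 * C w * p + D w"
    by metis
  have "f z = jet_cubic A B C D z" if "z \<in> U" for z
  proof -
    obtain x y p where "z = (x, y, p)" by (cases z)
    then show ?thesis
      using ABCD[of "(x, y)" p] that by (simp add: jet_cubic_def)
  qed
  then show ?thesis
    using jet_cubic_coeffs_analytic[OF assms(1,3)] by blast
qed

lemma dp_cubic_with_coeffs:
  assumes "open U" "cubic_with_coeffs U f A B C D" "z \<in> U"
  shows "dp f z = jet_cubic (\<lambda>_. 0) A (\<lambda>w. 2 * B w) (\<lambda>w. 3 * C w) z"
    and "dp (dp f) z = jet_cubic (\<lambda>_. 0) (\<lambda>_. 0) (\<lambda>w. 2 * A w) (\<lambda>w. 6 * B w) z"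
    and "dp (dp (dp f)) z = jet_cubic (\<lambda>_. 0) (\<lambda>_. 0) (\<lambda>_. 0) (\<lambda>w. 6 * A w) z"
    and "dp (dp (dp (dp f))) z = 0"
proof -
  have 0: "f z = jet_cubic A B C D z" if "z \<in> U" for z
    using assms(2) that by (simp add: cubic_with_coeffs_iff)
  have 1: "dp f z = jet_cubic (\<lambda>_. 0) A (\<lambda>w. 2 * B w) (\<lambda>w. 3 * C w) z" if "z \<in> U" for z
    using jet_partials_cong(3)[OF assms(1) that 0] by (simp add: dp_jet_cubic)
  have 2: "dp (dp f) z = jet_cubic (\<lambda>_. 0) (\<lambda>_. 0) (\<lambda>w. 2 * A w) (\<lambda>w. 6 * B w) z" if "z \<in> U" for z
    using jet_partials_cong(3)[OF assms(1) that 1] by (simp add: dp_jet_cubic)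
  have 3: "dp (dp (dp f)) z = jet_cubic (\<lambda>_. 0) (\<lambda>_. 0) (\<lambda>_. 0) (\<lambda>w. 6 * A w) z" if "z \<in> U" for z
    using jet_partials_cong(3)[OF assms(1) that 2] by (simp add: dp_jet_cubic)
  have 4: "dp (dp (dp (dp f))) z = 0" if "z \<in> U" for z
  proof -
    have "dp (dp (dp (dp f))) z = jet_cubic (\<lambda>_. 0) (\<lambda>_. 0) (\<lambda>_. 0) (\<lambda>_. 0) z"
      using jet_partials_cong(3)[OF assms(1) that 3] by (simp add: dp_jet_cubic)
    then show ?thesis
      by (simp add: jet_cubic_def case_prod_unfold)
  qed
  from 1 2 3 4 assms(3) show
    "dp f z = jet_cubic (\<lambda>_. 0) A (\<lambda>w. 2 * B w) (\<lambda>w. 3 * C w) z"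
    "dp (dp f) z = jet_cubic (\<lambda>_. 0) (\<lambda>_. 0) (\<lambda>w. 2 * A w) (\<lambda>w. 6 * B w) z"
    "dp (dp (dp f)) z = jet_cubic (\<lambda>_. 0) (\<lambda>_. 0) (\<lambda>_. 0) (\<lambda>w. 6 * A w) z"
    "dp (dp (dp (dp f))) z = 0"
    by blast+
qed

text \<open>The scalars absorb the factors 0, 1, 2, 3, 6 that arise when a cubic is differentiated
  in \<open>p\<close>.\<close>

lemma dx_dy_jet_cubic:
  assumes "A real_analytic_on W" "B real_analytic_on W" "C real_analytic_on W" "D real_analytic_on W"
    and "(x, y) \<in> W"
  shows "dx (jet_cubic (\<lambda>w. a * A w) (\<lambda>w. b * B w) (\<lambda>w. c * C w) (\<lambda>w. d * D w)) (x, y, p) =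
      a * plane_dx A (x, y) * p^3 + 3 * b * plane_dx B (x, y) * p^2
      + 3 * c * plane_dx C (x, y) * p + d * plane_dx D (x, y)"
    and "dy (jet_cubic (\<lambda>w. a * A w) (\<lambda>w. b * B w) (\<lambda>w. c * C w) (\<lambda>w. d * D w)) (x, y, p) =
      a * plane_dy A (x, y) * p^3 + 3 * b * plane_dy B (x, y) * p^2
      + 3 * c * plane_dy C (x, y) * p + d * plane_dy D (x, y)"
  unfolding dx_def dy_def jet_cubic_def prod.case
  by (rule DERIV_imp_deriv, (rule derivative_eq_intros refl has_field_derivative_plane assms)+, simp)+

lemma dx_dy_cubic_with_coeffs:
  assumes U: "open U" and f: "cubic_with_coeffs U f A B C D" and z: "(x, y, p) \<in> U"
  shows "dy f (x, y, p) = plane_dy A (x, y) * p^3 + 3 * plane_dy B (x, y) * p^2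
      + 3 * plane_dy C (x, y) * p + plane_dy D (x, y)"
    and "dx (dp f) (x, y, p) =
      3 * plane_dx A (x, y) * p^2 + 6 * plane_dx B (x, y) * p + 3 * plane_dx C (x, y)"
    and "dy (dp f) (x, y, p) =
      3 * plane_dy A (x, y) * p^2 + 6 * plane_dy B (x, y) * p + 3 * plane_dy C (x, y)"
    and "dx (dp (dp f)) (x, y, p) = 6 * plane_dx A (x, y) * p + 6 * plane_dx B (x, y)"
    and "dy (dp (dp f)) (x, y, p) = 6 * plane_dy A (x, y) * p + 6 * plane_dy B (x, y)"
    and "dx (dp (dp (dp f))) (x, y, p) = 6 * plane_dx A (x, y)"
    and "dy (dp (dp (dp f))) (x, y, p) = 6 * plane_dy A (x, y)"
proof -
  have W: "(x, y) \<in> plane_projection U"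
    using z by (force simp: plane_projection_def)
  note an = f[unfolded cubic_with_coeffs_iff]
  note partials = jet_partials_cong(1,2)[OF U z]
    and dps = dp_cubic_with_coeffs[OF U f]
  have A: "A real_analytic_on plane_projection U" and B: "B real_analytic_on plane_projection U"
    and C: "C real_analytic_on plane_projection U" and D: "D real_analytic_on plane_projection U"
    using an by blast+
  have f_eq: "\<And>w. w \<in> U \<Longrightarrow> f w = jet_cubic A B C D w"
    using an by blast
  show "dy f (x, y, p) = plane_dy A (x, y) * p^3 + 3 * plane_dy B (x, y) * p^2
      + 3 * plane_dy C (x, y) * p + plane_dy D (x, y)"
    using partials(2)[OF f_eq] dx_dy_jet_cubic(2)[OF A B C D W, of 1 1 1 1] by simp
  show "dx (dp f) (x, y, p) =
      3 * plane_dx A (x, y) * p^2 + 6 * plane_dx B (x, y) * p + 3 * plane_dx C (x, y)"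
    \<comment> \<open>Where the scalar is 0, \<open>A\<close> merely fills the slot with some
      analytic function; the same device recurs below.\<close>
    using partials(1)[OF dps(1)] dx_dy_jet_cubic(1)[OF A A B C W, of 0 1 2 3] by simp
  show "dy (dp f) (x, y, p) =
      3 * plane_dy A (x, y) * p^2 + 6 * plane_dy B (x, y) * p + 3 * plane_dy C (x, y)"
    using partials(2)[OF dps(1)] dx_dy_jet_cubic(2)[OF A A B C W, of 0 1 2 3] by simp
  show "dx (dp (dp f)) (x, y, p) = 6 * plane_dx A (x, y) * p + 6 * plane_dx B (x, y)"
    using partials(1)[OF dps(2)] dx_dy_jet_cubic(1)[OF A A A B W, of 0 0 2 6] by simp
  show "dy (dp (dp f)) (x, y, p) = 6 * plane_dy A (x, y) * p + 6 * plane_dy B (x, y)"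
    using partials(2)[OF dps(2)] dx_dy_jet_cubic(2)[OF A A A B W, of 0 0 2 6] by simp
  show "dx (dp (dp (dp f))) (x, y, p) = 6 * plane_dx A (x, y)"
    using partials(1)[OF dps(3)] dx_dy_jet_cubic(1)[OF A A A A W, of 0 0 0 6] by simp
  show "dy (dp (dp (dp f))) (x, y, p) = 6 * plane_dy A (x, y)"
    using partials(2)[OF dps(3)] dx_dy_jet_cubic(2)[OF A A A A W, of 0 0 0 6] by simp
qed

section \<open>The invariants of a cubic\<close>

text \<open>\<open>compat1\<close>, \<open>compat2\<close>, \<open>compat3\<close> are the
  differences \<open>E\<^sub>1\<close>, \<open>E\<^sub>2\<close>, \<open>E\<^sub>3\<close>, numbered
  as the equations for the coefficients.\<close>

definition compat1 where
  "compat1 B C D w = plane_dy D w - plane_dx C w - 2 * (B w * D w - (C w)^2)"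

definition compat2 where
  "compat2 A B C D w = plane_dy C w - plane_dx B w - (A w * D w - B w * C w)"

definition compat3 where
  "compat3 A B C w = plane_dy B w - plane_dx A w - 2 * (A w * C w - (B w)^2)"

text \<open>Substitution of the derivatives: the terms of degree 3 and 4 in \<open>p\<close> cancel
  in \<open>K\<close>, those of degree 2 and 3 in \<open>I\<^sub>1\<close>. On such \<open>f\<close>
  one sees that \<open>I\<^sub>1\<close> is minus half the \<open>p\<close>-derivative of
  \<open>K\<close>.\<close>

lemma invariants_of_cubic:
  assumes U: "open U" and f: "cubic_with_coeffs U f A B C D" and z: "(x, y, p) \<in> U"
  shows "inv_K f (x, y, p) =
      compat3 A B C (x, y) * p^2 + 2 * compat2 A B C D (x, y) * p + compat1 B C D (x, y)"
    and "inv_I1 f (x, y, p) = - (compat3 A B C (x, y) * p + compat2 A B C D (x, y))"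
    and "inv_I2 f (x, y, p) u1 = 0"
    and "inv_I3 f (x, y, p) u1 u3 =
      compat3 A B C (x, y) / u1^2 + 2 * (u3 / u1) * inv_I1 f (x, y, p)"
proof -
  have f_eq: "f (x, y, p) = A (x, y) * p^3 + 3 * B (x, y) * p^2 + 3 * C (x, y) * p + D (x, y)"
    using f z by (simp add: cubic_with_coeffs_def)
  note eqs = f_eq dp_cubic_with_coeffs[OF U f z, unfolded jet_cubic_def prod.case]
    dx_dy_cubic_with_coeffs[OF U f z]
  note defs = total_deriv_def compat1_def compat2_def compat3_def
  show "inv_K f (x, y, p) =
      compat3 A B C (x, y) * p^2 + 2 * compat2 A B C D (x, y) * p + compat1 B C D (x, y)"
    by (simp add: inv_K_def defs eqs) (simp add: field_simps power2_eq_square power3_eq_cube)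
  show I1: "inv_I1 f (x, y, p) = - (compat3 A B C (x, y) * p + compat2 A B C D (x, y))"
    by (simp add: inv_I1_def defs eqs) (simp add: field_simps power2_eq_square power3_eq_cube)
  show "inv_I2 f (x, y, p) u1 = 0"
    by (simp add: inv_I2_def eqs)
  \<comment> \<open>The first bracket of \<open>I\<^sub>3\<close> loses all dependence on
    \<open>p\<close>; the second is \<open>I\<^sub>1\<close> with its summands reordered.\<close>
  have "1/6 * dy (dp (dp f)) (x, y, p) - 1/6 * total_deriv f (dp (dp (dp f))) (x, y, p)
      - 1/9 * dp f (x, y, p) * dp (dp (dp f)) (x, y, p) + 1/18 * (dp (dp f) (x, y, p))^2
      = compat3 A B C (x, y)"
    by (simp add: defs eqs) (simp add: field_simps power2_eq_square power3_eq_cube)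
  moreover have "- 1/18 * dp f (x, y, p) * dp (dp f) (x, y, p)
      + 1/6 * total_deriv f (dp (dp f)) (x, y, p) - 1/3 * dy (dp f) (x, y, p) = inv_I1 f (x, y, p)"
    by (simp add: inv_I1_def)
  ultimately show "inv_I3 f (x, y, p) u1 u3 =
      compat3 A B C (x, y) / u1^2 + 2 * (u3 / u1) * inv_I1 f (x, y, p)"
    unfolding inv_I3_def by simp
qed

text \<open>A nonempty open set of reals is infinite, while a nonzero polynomial has finitely many
  roots.\<close>

lemma quadratic_eq_zero_on_open:
  fixes a b c :: real
  assumes "open S" "S \<noteq> {}" "\<And>t. t \<in> S \<Longrightarrow> a * t^2 + b * t + c = 0"
  shows "a = 0" "b = 0" "c = 0"
proof -
  have "infinite {t. poly [:c, b, a:] t = 0}"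
  proof
    assume fin: "finite {t. poly [:c, b, a:] t = 0}"
    have "S \<subseteq> {t. poly [:c, b, a:] t = 0}"
      using assms(3) by (auto simp: algebra_simps power2_eq_square)
    then show False
      using fin finite_subset finite_imp_not_open assms(1,2) by blast
  qed
  then have "[:c, b, a:] = 0"
    using poly_roots_finite by blast
  then show "a = 0" "b = 0" "c = 0" by simp_all
qed

section \<open>Vanishing of the invariants as conditions on the coefficients\<close>

theorem proposition3p2:
  fixes U :: "(real \<times> real \<times> real) set" and f :: "real \<times> real \<times> real \<Rightarrow> real"
  assumes "open U"
    and "\<And>x y. is_interval {p. (x, y, p) \<in> U}"
    and "f real_analytic_on U"
  shows "((\<forall>z\<in>U. dp (dp (dp (dp f))) z = 0) \<longleftrightarrow> (\<exists>A B C D. cubic_with_coeffs U f A B C D)) \<and>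
    ((\<forall>z\<in>U. \<forall>u1 u3. u1 \<noteq> 0 \<longrightarrow>
        inv_K f z = 0 \<and> inv_I1 f z = 0 \<and> inv_I2 f z u1 = 0 \<and> inv_I3 f z u1 u3 = 0)
     \<longleftrightarrow>
     (\<forall>z\<in>U. dp (dp (dp (dp f))) z = 0) \<and>
     (\<exists>A B C D. cubic_with_coeffs U f A B C D \<and>
        (\<forall>w\<in>plane_projection U.
           plane_dy D w - plane_dx C w = 2 * (B w * D w - (C w)^2) \<and>
           plane_dy C w - plane_dx B w = A w * D w - B w * C w \<and>
           plane_dy B w - plane_dx A w = 2 * (A w * C w - (B w)^2))))"
    (is "(?quartic \<longleftrightarrow> ?cubic) \<and> (?invs \<longleftrightarrow> _ \<and> (\<exists>A B C D. _ \<and> ?eqs A B C D))")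
proof -
  have cubic: "?quartic \<longleftrightarrow> ?cubic"
    using cubic_with_coeffs_exists[OF assms] dp_cubic_with_coeffs(4)[OF assms(1)] by blast
  have eqs: "?eqs A B C D \<longleftrightarrow> (\<forall>w\<in>plane_projection U.
      compat1 B C D w = 0 \<and> compat2 A B C D w = 0 \<and> compat3 A B C w = 0)" for A B C D
    by (simp add: compat1_def compat2_def compat3_def)
  have "?quartic \<and> (\<exists>A B C D. cubic_with_coeffs U f A B C D \<and> ?eqs A B C D)" if ?invs
  proof -
    have ?quartic
    proof
      fix z assume "z \<in> U"
      \<comment> \<open>Any nonzero \<open>u1\<close> would do; 1 is convenient.\<close>
      then have "inv_I2 f z 1 = 0"
        using that by (metis zero_neq_one)
      then show "dp (dp (dp (dp f))) z = 0"
        by (simp add: inv_I2_def)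
    qed
    then obtain A B C D where ABCD: "cubic_with_coeffs U f A B C D"
      using cubic by blast
    have "compat1 B C D (x, y) = 0 \<and> compat2 A B C D (x, y) = 0 \<and> compat3 A B C (x, y) = 0"
      if xyp: "(x, y, p) \<in> U" for x y p
    proof -
      \<comment> \<open>The \<open>compat\<close> values depend on \<open>(x, y)\<close> only, so
        \<open>K\<close> vanishes as a quadratic in \<open>t\<close> along the whole slice through
        the given point.\<close>
      have K: "compat3 A B C (x, y) * t^2 + 2 * compat2 A B C D (x, y) * t + compat1 B C D (x, y) = 0"
        if "t \<in> {t. (x, y, t) \<in> U}" for t
        using invariants_of_cubic(1)[OF assms(1) ABCD, of x y t] \<open>?invs\<close> that
        by (metis mem_Collect_eq zero_neq_one)
      have "{t. (x, y, t) \<in> U} \<noteq> {}"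
        using xyp by blast
      from quadratic_eq_zero_on_open[OF open_jet_slices(3)[OF assms(1)] this K]
      show ?thesis by simp
    qed
    then have "?eqs A B C D"
      unfolding eqs by (auto simp: plane_projection_def)
    with \<open>?quartic\<close> ABCD show ?thesis by blast
  qed
  \<comment> \<open>Conversely, vanishing of the three \<open>compat\<close> terms makes every
    formula of \<open>invariants_of_cubic\<close> zero.\<close>
  moreover have ?invs if ABCD: "cubic_with_coeffs U f A B C D" "?eqs A B C D" for A B C D
  proof (intro ballI allI impI)
    fix z u1 u3 assume "z \<in> U"
    obtain x y p where z: "z = (x, y, p)" by (cases z)
    then have "(x, y) \<in> plane_projection U"
      using \<open>z \<in> U\<close> by (force simp: plane_projection_def)
    then have "compat1 B C D (x, y) = 0" "compat2 A B C D (x, y) = 0" "compat3 A B C (x, y) = 0"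
      using ABCD(2) unfolding eqs by blast+
    then show "inv_K f z = 0 \<and> inv_I1 f z = 0 \<and> inv_I2 f z u1 = 0 \<and> inv_I3 f z u1 u3 = 0"
      using invariants_of_cubic[OF assms(1) ABCD(1), of x y p] \<open>z \<in> U\<close> by (simp add: z)
  qed
  ultimately show ?thesis
    using cubic by blast
qed

end
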